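(* Let $\lambda\in\bigl[-\frac{\sqrt2}{2},\frac{\sqrt2}{2}\bigr]$ and let $V$ be a random variable with distribution function $H_\lambda(u)=u\bigl(1+\lambda\sin(\log u)\bigr)$, $0\le u\le 1$ (with $H_\lambda(0)=0$, $H_\lambda(1)=1$ and $H_\lambda'(u)\ge 0$ for $0<u<1$). Let $U$ be a random variable independent of $V$ and uniformly distributed on $(0,1)$. Put $S_1:=U$ and $S_2:=1-U$, and let $C_\lambda$ be the copula corresponding to the bivariate random vector $$\bm{X}:=-\frac V2\left(\frac1{S_1},\frac1{S_2}\right)^{\top}\in(-\infty,0]^2 .$$ If $\lambda\neq 0$, then $C_\lambda$ is not in the domain of attraction of a multivariate extreme value distribution, whereas $C_0$ is a generalized Pareto copula with corresponding $D$-norm $$\|\bm{x}\|_D=\|\bm{x}\|_1-\frac{|x_1||x_2|}{\|\bm{x}\|_1},\qquad \bm{x}=(x_1,x_2)^{\top}\neq\bm{0}.$$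
   Context: Operations and inequalities between vectors are componentwise; $\bm 0=(0,\dots,0)^\top$, $\bm 1=(1,\dots,1)^\top$, and $\|\bm x\|_1=\sum_i|x_i|$. A copula $C$ on $\mathbb{R}^d$ (a distribution function all of whose margins are uniform on $(0,1)$) is in the (max-)domain of attraction of an extreme value distribution $G$ on $\mathbb{R}^d$ if $C^n\left(\bm 1+\frac1n\bm x\right)\to G(\bm x)$ as $n\to\infty$ for all $\bm x\le\bm 0\in\mathbb{R}^d$. Here $G$ is a distribution function which is max-stable: $G^n(\bm x/n)=G(\bm x)$ for all $\bm x\in\mathbb{R}^d$, $n\in\mathbb{N}$. A norm $\|\cdot\|_D$ on $\mathbb{R}^d$ is called a $D$-norm if there is a copula $C$ on $\mathbb{R}^d$ with $C(\bm u)=1-\|\bm u-\bm 1\|_D+o(\|\bm u-\bm 1\|_D)$ uniformly for $\bm u\in[0,1]^d$ as $\bm u\uparrow\bm 1$. A copula $C$ is a generalized Pareto copula (GPC) with corresponding $D$-norm $\|\cdot\|_D$ if there is $\bm u_0\in[0,1)^d$ such that $C(\bm u)=1-\|\bm u-\bm 1\|_D$ for all $\bm u_0\le\bm u\le\bm 1$. The copula corresponding to a random vector with continuous univariate margins is the unique copula provided by Sklar's theorem; the margins of $\bm X$ are continuous. *)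

theory Defs
  imports "HOL-Probability.Probability" "HOL-Library.Landau_Symbols"
begin

text \<open>The order on \<^typ>\<open>real ^ 'd\<close> is componentwise, so \<open>{..x}\<close> is a lower-left orthant,
  \<open>{0..1}\<close> is the unit cube, and \<open>0\<close>, \<open>1\<close> are the constant vectors. The strict order
  \<open><\<close> of the library is not componentwise and is avoided below.\<close>

definition is_distribution_function :: "(real ^ 'd \<Rightarrow> real) \<Rightarrow> bool" where
  "is_distribution_function F \<longleftrightarrow>
     (\<exists>M. prob_space M \<and> sets M = sets borel \<and> (\<forall>x. F x = measure M {..x}))"

definition is_copula :: "(real ^ 'd \<Rightarrow> real) \<Rightarrow> bool" where
  "is_copula C \<longleftrightarrow>
     (\<exists>M. prob_space M \<and> sets M = sets borel \<and> (\<forall>x. C x = measure M {..x}) \<and>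
          (\<forall>i. distr M borel (\<lambda>x. x $ i) = uniform_measure lborel {0<..<1}))"

text \<open>The copula of a random vector with continuous margins, as determined by Sklar's theorem:
  \<open>P(X \<le> x) = C (F\<^sub>1 x\<^sub>1, \<dots>, F\<^sub>d x\<^sub>d)\<close>. A copula is a function on the whole
  space here, but its values are determined by those on the unit cube, so it is unique.\<close>

definition copula_of :: "'a measure \<Rightarrow> ('a \<Rightarrow> real ^ 'd) \<Rightarrow> real ^ 'd \<Rightarrow> real" where
  "copula_of M X = (THE C. is_copula C \<and>
     (\<forall>x. measure (distr M borel X) {..x} =
          C (\<chi> i. cdf (distr M borel (\<lambda>\<omega>. X \<omega> $ i)) (x $ i))))"

definition is_extreme_value_distribution :: "(real ^ 'd \<Rightarrow> real) \<Rightarrow> bool" where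
  "is_extreme_value_distribution G \<longleftrightarrow>
     is_distribution_function G \<and> (\<forall>n\<ge>1. \<forall>x. G ((1 / real n) *\<^sub>R x) ^ n = G x)"

definition in_domain_of_attraction :: "(real ^ 'd \<Rightarrow> real) \<Rightarrow> (real ^ 'd \<Rightarrow> real) \<Rightarrow> bool" where
  "in_domain_of_attraction C G \<longleftrightarrow>
     is_copula C \<and> is_extreme_value_distribution G \<and>
     (\<forall>x\<le>0. (\<lambda>n. C (1 + (1 / real n) *\<^sub>R x) ^ n) \<longlonglongrightarrow> G x)"

definition is_norm :: "('v::real_vector \<Rightarrow> real) \<Rightarrow> bool" where
  "is_norm N \<longleftrightarrow>
     (\<forall>x. 0 \<le> N x) \<and> (\<forall>x. N x = 0 \<longleftrightarrow> x = 0) \<and>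
     (\<forall>a x. N (a *\<^sub>R x) = \<bar>a\<bar> * N x) \<and> (\<forall>x y. N (x + y) \<le> N x + N y)"

definition norm_1 :: "real ^ 'd \<Rightarrow> real" where
  "norm_1 x = (\<Sum>i\<in>UNIV. \<bar>x $ i\<bar>)"

text \<open>Uniformity of the remainder in \<open>u\<close> is expressed by the neighbourhood filter of the
  vector \<open>1\<close> within the unit cube.\<close>

definition is_D_norm :: "(real ^ 'd \<Rightarrow> real) \<Rightarrow> bool" where
  "is_D_norm N \<longleftrightarrow> is_norm N \<and>
     (\<exists>C. is_copula C \<and>
        (\<lambda>u. C u - (1 - N (u - 1))) \<in> o[at 1 within {0..1}](\<lambda>u. N (u - 1)))"

definition is_GPC :: "(real ^ 'd \<Rightarrow> real) \<Rightarrow> (real ^ 'd \<Rightarrow> real) \<Rightarrow> bool" where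
  "is_GPC C N \<longleftrightarrow> is_copula C \<and> is_D_norm N \<and>
     (\<exists>u0. (\<forall>i. 0 \<le> u0 $ i \<and> u0 $ i < 1) \<and>
           (\<forall>u. u0 \<le> u \<and> u \<le> 1 \<longrightarrow> C u = 1 - N (u - 1)))"

text \<open>Only used for arguments in \<open>[0, 1]\<close>; the factor \<open>u\<close> gives the value 0 at \<open>u = 0\<close>.\<close>

definition H :: "real \<Rightarrow> real \<Rightarrow> real" where
  "H lam u = u * (1 + lam * sin (ln u))"

lemma H_0 [simp]: "H lam 0 = 0"
  by (simp add: H_def)

lemma H_1 [simp]: "H lam 1 = 1"
  by (simp add: H_def)

lemma DERIV_H:
  assumes "0 < u"
  shows "(H lam has_real_derivative 1 + lam * (sin (ln u) + cos (ln u))) (at u)"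
  unfolding H_def using assms
  by (auto intro!: derivative_eq_intros simp: field_simps)

lemma deriv_H_nonneg:
  assumes "lam \<in> {- (sqrt 2 / 2)..sqrt 2 / 2}" "0 < u"
  shows "0 \<le> deriv (H lam) u"
proof -
  define t where "t = ln u"
  have "(sin t + cos t)\<^sup>2 + (sin t - cos t)\<^sup>2 = 2 * ((sin t)\<^sup>2 + (cos t)\<^sup>2)"
    by (simp add: power2_eq_square algebra_simps)
  then have "(sin t + cos t)\<^sup>2 \<le> 2"
    using zero_le_power2[of "sin t - cos t"] unfolding sin_cos_squared_add by linarith
  then have 1: "\<bar>sin t + cos t\<bar> \<le> sqrt 2"
    by (metis real_sqrt_abs real_sqrt_le_mono)
  have 2: "\<bar>lam\<bar> \<le> sqrt 2 / 2"
    using assms(1) by auto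
  have "\<bar>lam * (sin t + cos t)\<bar> \<le> sqrt 2 / 2 * sqrt 2"
    unfolding abs_mult using 1 2 by (intro mult_mono) auto
  then have "\<bar>lam * (sin t + cos t)\<bar> \<le> 1"
    by simp
  then show ?thesis
    using DERIV_imp_deriv[OF DERIV_H[OF assms(2), of lam]] by (simp add: t_def abs_le_iff)
qed

end

theory Submission
  imports Defs "HOL-Real_Asymp.Real_Asymp"
begin

text \<open>Let \<open>B t\<close> be the average of \<open>H lam\<close> over \<open>{0..t}\<close>. Conditioning on \<open>U\<close> gives, for \<open>s\<close>
  and \<open>t\<close> in \<open>{0..1 / 2}\<close>, the margins \<open>P(X\<^sub>i \<le> -s) = 1 - B (2 s)\<close> and
  \<open>P(X\<^sub>1 \<le> -s, X\<^sub>2 \<le> -t) = 1 - (B (2 s) + B (2 t) - B (2 s t / (s + t)))\<close>. For \<open>lam = 0\<close> we have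
  \<open>B t = t / 2\<close>, and the copula can be read off. In general, choosing \<open>B \<tau>\<^sub>n = 1 / n\<close>, the copula at
  \<open>(1 - 1 / n, 1 - 1 / n)\<close> is \<open>1 - 2 / n + B (\<tau>\<^sub>n / 2)\<close>; if its \<open>n\<close>-th power converges, then
  \<open>B (t / 2) / B t\<close> converges as \<open>t\<close> decreases to 0. For \<open>lam \<noteq> 0\<close> this ratio is a nonconstant periodic
  function of \<open>ln t\<close>.\<close>

subsection \<open>Sklar's theorem for continuous margins\<close>

lemma borel_measurable_vecI:
  fixes f :: "'a \<Rightarrow> real ^ 'd"
  assumes "\<And>i. (\<lambda>x. f x $ i) \<in> borel_measurable M"
  shows "f \<in> borel_measurable M"
proof (subst borel_measurable_euclidean_space, rule ballI)
  fix b :: "real ^ 'd" assume "b \<in> Basis"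
  then obtain i where "b = axis i 1"
    by (auto simp: Basis_vec_def)
  then show "(\<lambda>x. f x \<bullet> b) \<in> borel_measurable M"
    using assms[of i] by (simp add: inner_axis)
qed

lemma borel_measurable_vec_nth [measurable]: "(\<lambda>x::real^'d. x $ i) \<in> borel_measurable borel"
  by (intro borel_measurable_continuous_onI continuous_intros)

text \<open>Links two descriptions of the uniform law: the quantile transform
  \<open>distr_I_eq_M\<close> starts from a restriction of \<open>lborel\<close>, copulas from
  \<open>uniform_measure\<close>.\<close>

lemma distr_restrict_lborel_unit_interval:
  "distr (restrict_space lborel {0<..<1::real}) borel (\<lambda>x. x) = uniform_measure lborel {0<..<1}"
proof (rule measure_eqI)
  fix A :: "real set" assume "A \<in> sets (distr (restrict_space lborel {0<..<1}) borel (\<lambda>x. x))"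
  then have A[measurable]: "A \<in> sets borel" by simp
  have "(\<lambda>x. x) \<in> restrict_space lborel {0<..<1::real} \<rightarrow>\<^sub>M borel"
    by (rule measurable_restrict_space1) simp
  then have "emeasure (distr (restrict_space lborel {0<..<1}) borel (\<lambda>x. x)) A =
      emeasure (restrict_space lborel {0<..<1}) (A \<inter> {0<..<1})"
    by (subst emeasure_distr) (auto simp: space_restrict_space)
  also have "\<dots> = emeasure lborel (A \<inter> {0<..<1})"
    by (subst emeasure_restrict_space) auto
  finally show "emeasure (distr (restrict_space lborel {0<..<1}) borel (\<lambda>x. x)) A =
      emeasure (uniform_measure lborel {0<..<1}) A"
    by (simp add: Int_commute divide_ennreal_def)
qed simp

text \<open>Probability integral transform: \<open>M\<close> is the image of the uniform law under
  the quantile function \<open>I\<close>, and continuity gives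
  \<open>C (I \<omega>) = \<omega>\<close>, so \<open>C\<close> maps \<open>M\<close> back to that
  law.\<close>

lemma (in real_distribution) distr_cdf_uniform:
  assumes cts: "\<And>x. isCont (cdf M) x"
  shows "distr M borel (cdf M) = uniform_measure lborel {0<..<1}"
proof -
  interpret cdf_distribution M
    by unfold_locales
  have CI: "C (I \<omega>) = \<omega>" if "\<omega> \<in> {0<..<1}" for \<omega>
  proof (rule antisym)
    \<comment> \<open>Left of \<open>I \<omega>\<close> the values of \<open>C\<close> stay below
      \<open>\<omega>\<close>; continuity rules out a jump at the point itself.\<close>
    have "C x \<le> \<omega>" if "x < I \<omega>" for x
      using pseudoinverse[of \<omega> x] that \<open>\<omega> \<in> {0<..<1}\<close> by auto
    then have "eventually (\<lambda>x. C x \<le> \<omega>) (at_left (I \<omega>))"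
      by (simp add: eventually_at_filter)
    moreover have "(C \<longlongrightarrow> C (I \<omega>)) (at_left (I \<omega>))"
      using cts[of "I \<omega>"] by (simp add: isCont_def filterlim_at_split)
    ultimately show "C (I \<omega>) \<le> \<omega>"
      by (intro tendsto_upperbound[where F = "at_left (I \<omega>)"]) auto
    show "\<omega> \<le> C (I \<omega>)"
      using pseudoinverse[of \<omega> "I \<omega>"] that by auto
  qed
  have "distr M borel C = distr (distr (restrict_space lborel {0<..<1}) borel I) borel C"
    by (simp only: distr_I_eq_M)
  also have "\<dots> = distr (restrict_space lborel {0<..<1}) borel (C \<circ> I)"
    by (intro distr_distr) auto
  also have "\<dots> = distr (restrict_space lborel {0<..<1::real}) borel (\<lambda>x. x)"
    by (intro distr_cong) (auto simp: CI space_restrict_space)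
  finally show ?thesis
    by (simp add: distr_restrict_lborel_unit_interval)
qed

section \<open>Copulas are determined by their values on the open unit cube\<close>

lemma AE_copula_margin:
  assumes M: "sets M = sets borel"
    and i: "distr M borel (\<lambda>x::real^'d. x $ i) = uniform_measure lborel {0<..<1}"
  shows "AE x in M. 0 < x $ i \<and> x $ i < 1"
proof -
  have [measurable]: "(\<lambda>x. x $ i) \<in> borel_measurable M"
    unfolding measurable_cong_sets[OF M refl] by simp
  have "AE y in uniform_measure lborel {0<..<1::real}. 0 < y \<and> y < 1"
    by (rule AE_uniform_measureI) auto
  then have "AE y in distr M borel (\<lambda>x. x $ i). 0 < y \<and> y < 1"
    by (simp only: i)
  then show ?thesis
    by (subst (asm) AE_distr_iff) auto
qed

lemma copula_eq_0:
  assumes "is_copula C" "u $ i \<le> 0"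
  shows "C u = 0"
proof -
  obtain M where M: "prob_space M" "sets M = sets borel" "\<And>x. C x = measure M {..x}"
    "\<And>i. distr M borel (\<lambda>x. x $ i) = uniform_measure lborel {0<..<1}"
    using assms(1) unfolding is_copula_def by blast
  interpret prob_space M by fact
  have "AE x in M. x \<notin> {..u}"
    using AE_copula_margin[OF M(2) M(4)[of i]]
    by eventually_elim (use assms(2) in \<open>auto simp: less_eq_vec_def intro!: exI[of _ i]\<close>)
  then show ?thesis
    using M by (simp add: prob_eq_0)
qed

text \<open>The truncated orthants increase to \<open>{..u}\<close> up to a null set, since almost
  surely all coordinates are below 1. The offset 2 keeps the truncation level positive already for
  \<open>n = 0\<close>.\<close>

lemma copula_tendsto_min:
  assumes "is_copula C"
  shows "(\<lambda>n. C (\<chi> i. min (u $ i) (1 - 1 / (real n + 2)))) \<longlonglongrightarrow> C u"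
proof -
  obtain M where M: "prob_space M" "sets M = sets borel" "\<And>x. C x = measure M {..x}"
    "\<And>i. distr M borel (\<lambda>x. x $ i) = uniform_measure lborel {0<..<1}"
    using assms(1) unfolding is_copula_def by blast
  interpret prob_space M by fact
  define p where "p n = (\<chi> i. min (u $ i) (1 - 1 / (real n + 2)))" for n
  have lim: "(\<lambda>n. 1 - 1 / (real n + 2)) \<longlonglongrightarrow> 1"
    by real_asymp
  have inc: "1 - 1 / (real m + 2) \<le> 1 - 1 / (real n + 2)" if "m \<le> n" for m n
    using that by (simp add: frac_le)
  have "incseq (\<lambda>n. {..p n})"
    using inc by (fastforce simp: incseq_def p_def less_eq_vec_def intro: order_trans)
  then have "(\<lambda>n. prob {..p n}) \<longlonglongrightarrow> prob (\<Union>n. {..p n})"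
    by (intro finite_Lim_measure_incseq) (auto simp: M(2))
  moreover have "prob (\<Union>n. {..p n}) = prob {..u}"
  proof (rule finite_measure_eq_AE)
    have "AE x in M. \<forall>i. 0 < x $ i \<and> x $ i < 1"
      using AE_copula_margin[OF M(2) M(4)] by (simp add: AE_all_countable)
    then show "AE x in M. x \<in> (\<Union>n. {..p n}) \<longleftrightarrow> x \<in> {..u}"
    proof eventually_elim
      case (elim x)
      have "eventually (\<lambda>n. \<forall>i. x $ i < 1 - 1 / (real n + 2)) sequentially"
        using elim by (intro eventually_all_finite order_tendstoD(1)[OF lim]) auto
      then obtain n where "\<forall>i. x $ i < 1 - 1 / (real n + 2)"
        using eventually_happens'[OF sequentially_bot] by blast
      then have "\<forall>i. x $ i \<le> 1 - 1 / (real n + 2)"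
        by (simp add: less_imp_le)
      then show ?case
        by (auto simp: p_def less_eq_vec_def intro!: exI[of _ n])
    qed
  qed (auto simp: M(2))
  ultimately show ?thesis
    by (simp add: M(3) p_def)
qed

text \<open>Made for the uniqueness in Sklar's theorem: a continuous margin attains every value
  strictly between 0 and 1, but possibly neither endpoint.\<close>

lemma copula_eqI:
  assumes C: "is_copula C" and D: "is_copula D"
    and eq: "\<And>p. (\<And>i. 0 < p $ i \<and> p $ i < 1) \<Longrightarrow> C p = D p"
  shows "C = D"
proof
  fix u
  show "C u = D u"
  proof (cases "\<exists>i. u $ i \<le> 0")
    case True
    then show ?thesis using copula_eq_0[OF C] copula_eq_0[OF D] by metis
  next
    case False
    have "C (\<chi> i. min (u $ i) (1 - 1 / (real n + 2))) = D (\<chi> i. min (u $ i) (1 - 1 / (real n + 2)))" for n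
      by (rule eq) (use False in \<open>auto simp: not_le min_less_iff_disj\<close>)
    then show ?thesis
      using copula_tendsto_min[OF C, of u] copula_tendsto_min[OF D, of u] LIMSEQ_unique by force
  qed
qed

lemma (in real_distribution) cdf_surj_Ioo:
  assumes cont: "\<And>x. isCont (cdf M) x" and p: "0 < p" "p < 1"
  obtains x where "cdf M x = p"
proof -
  obtain a where a: "cdf M a < p"
    using eventually_happens'[OF _ order_tendstoD(2)[OF cdf_lim_at_bot p(1)]] by auto
  obtain b where b: "p < cdf M b"
    using eventually_happens'[OF _ order_tendstoD(1)[OF cdf_lim_at_top_prob p(2)]] by auto
  have "a \<le> b"
    using a b cdf_nondecreasing[of b a] by linarith
  with IVT[of "cdf M" a p b] a b cont that show ?thesis
    by auto
qed

section \<open>Existence and uniqueness of the copula of a random vector\<close>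

context prob_space
begin

context
  fixes X :: "'a \<Rightarrow> real ^ 'd"
  assumes X[measurable]: "X \<in> borel_measurable M"
    and cont: "\<And>i x. isCont (cdf (distr M borel (\<lambda>\<omega>. X \<omega> $ i))) x"
begin

lemma measurable_vec_nth_rv [measurable]: "(\<lambda>\<omega>. X \<omega> $ i) \<in> borel_measurable M"
  by measurable

abbreviation (input) margin :: "'d \<Rightarrow> real \<Rightarrow> real" where
  "margin i \<equiv> cdf (distr M borel (\<lambda>\<omega>. X \<omega> $ i))"

lemma margin_measurable [measurable]: "margin i \<in> borel_measurable borel"
  using cont by (intro borel_measurable_continuous_onI) (simp add: continuous_on_eq_continuous_at)

text \<open>The witness is the distribution function of the vector \<open>Y\<close> of transformed
  coordinates, whose margins are uniform by the probability integral transform.\<close>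

lemma sklar_exists:
  "\<exists>C. is_copula C \<and> (\<forall>x. measure (distr M borel X) {..x} = C (\<chi> i. margin i (x $ i)))"
proof -
  define Y where "Y \<omega> = (\<chi> i. margin i (X \<omega> $ i))" for \<omega>
  define N where "N = distr M borel Y"
  have Y[measurable]: "Y \<in> borel_measurable M"
    unfolding Y_def by (rule borel_measurable_vecI) simp
  have real: "real_distribution (distr M borel (\<lambda>\<omega>. X \<omega> $ i))" for i
    by simp
  have uniform: "distr M borel (\<lambda>\<omega>. margin i (X \<omega> $ i)) = uniform_measure lborel {0<..<1}" for i
  proof -
    have "distr M borel (\<lambda>\<omega>. margin i (X \<omega> $ i)) = distr (distr M borel (\<lambda>\<omega>. X \<omega> $ i)) borel (margin i)"
      by (subst distr_distr) (auto simp: comp_def)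
    also have "\<dots> = uniform_measure lborel {0<..<1}"
      by (rule real_distribution.distr_cdf_uniform[OF real cont])
    finally show ?thesis .
  qed
  have "is_copula (\<lambda>x. measure N {..x})"
    unfolding is_copula_def
  proof (intro exI conjI allI)
    show "prob_space N" unfolding N_def by (rule prob_space_distr) simp
    fix i
    have "distr N borel (\<lambda>x. x $ i) = distr M borel (\<lambda>\<omega>. margin i (X \<omega> $ i))"
      unfolding N_def by (subst distr_distr)
        (auto simp: comp_def Y_def)
    then show "distr N borel (\<lambda>x. x $ i) = uniform_measure lborel {0<..<1}"
      by (simp add: uniform)
  qed (auto simp: N_def)
  moreover have "measure (distr M borel X) {..x} = measure N {..(\<chi> i. margin i (x $ i))}" for x
  proof -
    \<comment> \<open>The two events may differ where the margin is flat, but they are nested and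
      both have probability \<open>margin i (x $ i)\<close>.\<close>
    have "AE \<omega> in M. X \<omega> $ i \<le> x $ i \<longleftrightarrow> margin i (X \<omega> $ i) \<le> margin i (x $ i)" for i
    proof -
      let ?A = "{\<omega>\<in>space M. X \<omega> $ i \<le> x $ i}"
      let ?B = "{\<omega>\<in>space M. margin i (X \<omega> $ i) \<le> margin i (x $ i)}"
      have AB: "?A \<subseteq> ?B"
        by (auto intro!: finite_borel_measure.cdf_nondecreasing real_distribution.finite_borel_measure_M)
      have A: "prob ?A = margin i (x $ i)"
        by (simp add: cdf_def measure_distr vimage_def Int_def conj_commute)
      have m01: "0 \<le> margin i (x $ i)" "margin i (x $ i) \<le> 1"
        using real_distribution.cdf_bounded_prob[OF real] by (auto simp: cdf_def)
      have "prob ?B = measure (uniform_measure lborel {0<..<1}) {..margin i (x $ i)}"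
        by (simp add: uniform[symmetric, of i] measure_distr vimage_def Int_def conj_commute)
      also have "\<dots> = measure lborel ({0<..<1} \<inter> {..margin i (x $ i)})"
        by simp
      also have "\<dots> = measure lborel {0<..<margin i (x $ i)}"
      proof -
        have "AE y in lborel. y \<noteq> margin i (x $ i)"
          by (rule AE_lborel_singleton)
        then have "emeasure lborel ({0<..<1} \<inter> {..margin i (x $ i)}) = emeasure lborel {0<..<margin i (x $ i)}"
          using m01 by (intro emeasure_eq_AE) auto
        then show ?thesis by (simp add: measure_def)
      qed
      also have "\<dots> = margin i (x $ i)"
        using m01 by simp
      finally have "prob (?B - ?A) = 0"
        using A AB by (subst finite_measure_Diff) auto
      then have "AE \<omega> in M. \<omega> \<notin> ?B - ?A"
        by (subst (asm) prob_eq_0) auto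
      with AE_space show ?thesis
        by eventually_elim (use AB in auto)
    qed
    then have ae: "AE \<omega> in M. \<forall>i. X \<omega> $ i \<le> x $ i \<longleftrightarrow> margin i (X \<omega> $ i) \<le> margin i (x $ i)"
      by (simp add: AE_all_countable)
    have "prob (X -` {..x} \<inter> space M) = prob (Y -` {..(\<chi> i. margin i (x $ i))} \<inter> space M)"
    proof (rule finite_measure_eq_AE)
      show "AE \<omega> in M. \<omega> \<in> X -` {..x} \<inter> space M \<longleftrightarrow>
          \<omega> \<in> Y -` {..(\<chi> i. margin i (x $ i))} \<inter> space M"
        using ae by eventually_elim (auto simp: less_eq_vec_def Y_def)
    qed auto
    then show ?thesis
      by (simp add: N_def measure_distr)
  qed
  ultimately show ?thesis by blast
qed

theorem copula_of_props:
  shows "is_copula (copula_of M X)"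
    and "measure (distr M borel X) {..x} = copula_of M X (\<chi> i. margin i (x $ i))"
proof -
  have "\<exists>!C. is_copula C \<and> (\<forall>x. measure (distr M borel X) {..x} = C (\<chi> i. margin i (x $ i)))"
  proof (rule ex_ex1I[OF sklar_exists], elim conjE)
    fix C D
    assume C: "is_copula C" "\<forall>x. measure (distr M borel X) {..x} = C (\<chi> i. margin i (x $ i))"
      and D: "is_copula D" "\<forall>x. measure (distr M borel X) {..x} = D (\<chi> i. margin i (x $ i))"
    show "C = D"
    proof (rule copula_eqI[OF C(1) D(1)])
      fix p :: "real ^ 'd" assume p: "\<And>i. 0 < p $ i \<and> p $ i < 1"
      have "\<exists>x. margin i x = p $ i" for i
        by (metis real_distribution.cdf_surj_Ioo real_distribution_distr[OF measurable_vec_nth_rv] cont p)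
      then obtain y where "\<And>i. margin i (y i) = p $ i"
        by metis
      then have "(\<chi> i. margin i ((\<chi> i. y i) $ i)) = p"
        by (simp add: vec_eq_iff)
      then show "C p = D p"
        using C(2) D(2) by metis
    qed
  qed
  from theI'[OF this] show "is_copula (copula_of M X)"
    and "measure (distr M borel X) {..x} = copula_of M X (\<chi> i. margin i (x $ i))"
    unfolding copula_of_def by blast+
qed

end

end

subsection \<open>Averages of \<open>H\<close>\<close>

text \<open>Meant for functions \<open>t * p (ln t)\<close> with bounded \<open>p\<close>, which
  oscillate near 0: the bound squeezes them there and at \<open>t = 0\<close> forces
  \<open>f 0 = 0\<close>.\<close>

lemma continuous_on_Ici_linear_bound:
  fixes f :: "real \<Rightarrow> real"
  assumes f: "continuous_on {0<..} f" and bound: "\<And>t. 0 \<le> t \<Longrightarrow> \<bar>f t\<bar> \<le> c * t"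
  shows "continuous_on {0..} f"
proof (rule continuous_on_eq_continuous_within[THEN iffD2], rule ballI)
  fix x :: real assume x: "x \<in> {0..}"
  show "continuous (at x within {0..}) f"
  proof (cases "x = 0")
    case False
    then have "isCont f x"
      using f x by (auto simp: continuous_on_eq_continuous_at)
    then show ?thesis
      by (rule continuous_at_imp_continuous_at_within)
  next
    case True
    have "((\<lambda>t. c * t) \<longlongrightarrow> 0) (at 0 within {0..})"
      by (auto intro!: tendsto_eq_intros)
    then have "(f \<longlongrightarrow> 0) (at 0 within {0..})"
      by (rule Lim_null_comparison[rotated]) (auto simp: eventually_at_filter bound)
    then show ?thesis
      using True bound[of 0] by (simp add: continuous_within)
  qed
qed

lemma continuous_on_H: "continuous_on {0..} (H lam)"
proof (rule continuous_on_Ici_linear_bound)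
  show "continuous_on {0<..} (H lam)"
    unfolding H_def by (intro continuous_intros) auto
  fix t :: real assume t: "0 \<le> t"
  have "\<bar>1 + lam * sin (ln t)\<bar> \<le> 1 + \<bar>lam\<bar> * 1"
    by (rule order_trans[OF abs_triangle_ineq]) (auto simp: abs_mult intro!: mult_left_le)
  then have "t * \<bar>1 + lam * sin (ln t)\<bar> \<le> t * (1 + \<bar>lam\<bar>)"
    using t by (intro mult_left_mono) auto
  then show "\<bar>H lam t\<bar> \<le> (1 + \<bar>lam\<bar>) * t"
    using t by (simp add: H_def abs_mult mult.commute)
qed

text \<open>\<open>H_avg lam t\<close> is the average of \<open>H lam\<close> over \<open>{0..t}\<close>, hence
  \<open>P(X\<^sub>i > -s) = H_avg lam (2 * s)\<close> for \<open>0 \<le> s \<le> 1 / 2\<close>.\<close>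

definition H_avg :: "real \<Rightarrow> real \<Rightarrow> real" where
  "H_avg lam t = t / 2 + lam * t / 5 * (2 * sin (ln t) - cos (ln t))"

lemma H_avg_0 [simp]: "H_avg lam 0 = 0"
  by (simp add: H_avg_def)

lemma H_avg_0_left [simp]: "H_avg 0 t = t / 2"
  by (simp add: H_avg_def)

lemma H_avg_eq: "H_avg lam t = t * (1 / 2 + lam / 5 * (2 * sin (ln t) - cos (ln t)))"
  by (simp add: H_avg_def algebra_simps)

lemma abs_two_sin_minus_cos_le: "\<bar>2 * sin x - cos x\<bar> \<le> (3::real)"
  using sin_le_one[of x] cos_le_one[of x] sin_ge_minus_one[of x] cos_ge_minus_one[of x] by linarith

lemma continuous_on_H_avg: "continuous_on {0..} (H_avg lam)"
proof (rule continuous_on_Ici_linear_bound)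
  show "continuous_on {0<..} (H_avg lam)"
    unfolding H_avg_def by (intro continuous_intros) auto
  fix t :: real assume t: "0 \<le> t"
  have "\<bar>1 / 2 + lam / 5 * (2 * sin (ln t) - cos (ln t))\<bar> \<le> 1 / 2 + \<bar>lam\<bar> / 5 * 3"
    by (rule order_trans[OF abs_triangle_ineq])
      (auto simp del: times_divide_eq_left simp: abs_mult intro!: mult_left_mono abs_two_sin_minus_cos_le)
  then have "t * \<bar>1 / 2 + lam / 5 * (2 * sin (ln t) - cos (ln t))\<bar> \<le> t * (1 / 2 + \<bar>lam\<bar> / 5 * 3)"
    using t by (intro mult_left_mono) auto
  then show "\<bar>H_avg lam t\<bar> \<le> (1 / 2 + \<bar>lam\<bar> / 5 * 3) * t"
    using t by (simp add: H_avg_eq abs_mult mult.commute)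
qed

text \<open>This antiderivative of \<open>H lam\<close>, which vanishes at 0, is what makes
  \<open>H_avg\<close> an average.\<close>

lemma DERIV_times_H_avg:
  assumes "0 < t"
  shows "((\<lambda>t. t * H_avg lam t) has_real_derivative H lam t) (at t)"
  unfolding H_def H_avg_def using assms
  by (auto intro!: derivative_eq_intros simp: field_simps)

lemma has_integral_H_scaled:
  assumes "0 \<le> c" "0 \<le> p" "p \<le> q"
  shows "((\<lambda>u. H lam (c * u)) has_integral q * H_avg lam (c * q) - p * H_avg lam (c * p)) {p..q}"
proof (cases "c = 0")
  case False
  with assms have c: "c > 0" by simp
  show ?thesis
  proof (rule fundamental_theorem_of_calculus_interior[OF \<open>p \<le> q\<close>])
    show "continuous_on {p..q} (\<lambda>u. u * H_avg lam (c * u))"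
      using assms by (intro continuous_intros continuous_on_compose2[OF continuous_on_H_avg]) auto
    fix u assume "u \<in> {p<..<q}"
    then have "0 < c * u" using assms c by auto
    from DERIV_times_H_avg[OF this, of lam]
    have "((\<lambda>u. (c * u) * H_avg lam (c * u) / c) has_real_derivative H lam (c * u) * c / c) (at u)"
      by (intro DERIV_cdivide DERIV_chain2[where f = "\<lambda>t. t * H_avg lam t" and g = "\<lambda>u. c * u"])
        (auto intro!: derivative_eq_intros)
    then show "((\<lambda>u. u * H_avg lam (c * u)) has_vector_derivative H lam (c * u)) (at u)"
      using c by (simp add: has_real_derivative_iff_has_vector_derivative)
  qed
qed auto

lemma has_integral_H_reflected:
  assumes "0 \<le> c" "p \<le> q" "q \<le> 1"
  shows "((\<lambda>u. H lam (c * (1 - u))) has_integral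
    (1 - p) * H_avg lam (c * (1 - p)) - (1 - q) * H_avg lam (c * (1 - q))) {p..q}"
proof -
  have "((\<lambda>u. H lam (c * u)) has_integral
      (1 - p) * H_avg lam (c * (1 - p)) - (1 - q) * H_avg lam (c * (1 - q))) {1 - q..1 - p}"
    using assms by (intro has_integral_H_scaled) auto
  then have "((\<lambda>u. H lam (c * (1 - u))) has_integral
      (1 - p) * H_avg lam (c * (1 - p)) - (1 - q) * H_avg lam (c * (1 - q))) ((\<lambda>u. 1 - u) ` {1 - q..1 - p})"
    using has_integral_affinity[of "\<lambda>u. H lam (c * u)" _ "1 - q" "1 - p" "-1" 1] by (simp add: image_def)
  moreover have "(\<lambda>u. 1 - u) ` {1 - q..1 - p} = {p..q}"
    by simp
  ultimately show ?thesis by simp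
qed

text \<open>The integrand is the conditional probability, given \<open>U = u\<close>, that
  \<open>V\<close> lies below the level at which one of the coordinates of \<open>X\<close> exceeds
  \<open>-a\<close> or \<open>-b\<close>. The interval is split where the two branches of the
  maximum cross.\<close>

lemma has_integral_H_max:
  assumes "0 \<le> a" "0 \<le> b"
  shows "((\<lambda>u. H lam (2 * max (u * a) ((1 - u) * b))) has_integral
    H_avg lam (2 * a) + H_avg lam (2 * b) - H_avg lam (2 * a * b / (a + b))) {0..1}"
proof (cases "a + b = 0")
  case True
  with assms show ?thesis by (simp add: add_nonneg_eq_0_iff)
next
  case False
  with assms have ab: "a + b > 0" by simp
  define v where "v = b / (a + b)"
  have v: "0 \<le> v" "v \<le> 1" and v': "1 - v = a / (a + b)"
    using assms ab by (auto simp: v_def field_simps)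
  let ?m = "2 * a * b / (a + b)"
  have "((\<lambda>u. H lam (2 * b * (1 - u))) has_integral H_avg lam (2 * b) - (1 - v) * H_avg lam (2 * b * (1 - v))) {0..v}"
    using has_integral_H_reflected[of "2 * b" 0 v lam] assms v by simp
  moreover have "2 * max (u * a) ((1 - u) * b) = 2 * b * (1 - u)" if "u \<in> {0..v}" for u
    using that ab unfolding v_def by (simp add: field_simps max_def)
  ultimately have 1: "((\<lambda>u. H lam (2 * max (u * a) ((1 - u) * b))) has_integral
      H_avg lam (2 * b) - (1 - v) * H_avg lam (2 * b * (1 - v))) {0..v}"
    by (subst has_integral_cong) (auto simp: mult.assoc)
  have "((\<lambda>u. H lam (2 * a * u)) has_integral H_avg lam (2 * a) - v * H_avg lam (2 * a * v)) {v..1}"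
    using has_integral_H_scaled[of "2 * a" v 1 lam] assms v by simp
  moreover have "2 * max (u * a) ((1 - u) * b) = 2 * a * u" if "u \<in> {v..1}" for u
    using that ab unfolding v_def by (simp add: field_simps max_def)
  ultimately have 2: "((\<lambda>u. H lam (2 * max (u * a) ((1 - u) * b))) has_integral
      H_avg lam (2 * a) - v * H_avg lam (2 * a * v)) {v..1}"
    by (subst has_integral_cong) (auto simp: mult.assoc)
  \<comment> \<open>At the crossing point both branches have the same argument, so the weights
    \<open>1 - v\<close> and \<open>v\<close> of the boundary terms add up to 1.\<close>
  have m: "2 * b * (1 - v) = ?m" "2 * a * v = ?m"
    unfolding v' by (simp_all add: v_def)
  from has_integral_combine[OF v 1 2] show ?thesis
    unfolding m by (rule has_integral_eq_rhs) (simp add: algebra_simps)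
qed

subsection \<open>The distribution of the random vector\<close>

text \<open>Independence makes the joint law a product measure, so the first variable can be
  conditioned on.\<close>

lemma (in prob_space) emeasure_indep_var:
  assumes indep: "indep_var S X T Y" and Q: "Q \<in> sets (S \<Otimes>\<^sub>M T)"
  shows "emeasure M {\<omega>\<in>space M. (X \<omega>, Y \<omega>) \<in> Q} =
    (\<integral>\<^sup>+x. emeasure (distr M T Y) (Pair x -` Q) \<partial>distr M S X)"
proof -
  have [measurable]: "X \<in> M \<rightarrow>\<^sub>M S" "Y \<in> M \<rightarrow>\<^sub>M T"
    using indep by (auto dest: indep_var_rv1 indep_var_rv2)
  interpret Y: prob_space "distr M T Y" by (rule prob_space_distr) simp
  have "emeasure M {\<omega>\<in>space M. (X \<omega>, Y \<omega>) \<in> Q} = emeasure (distr M (S \<Otimes>\<^sub>M T) (\<lambda>\<omega>. (X \<omega>, Y \<omega>))) Q"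
    using Q by (subst emeasure_distr) (auto simp: vimage_def Int_def conj_commute)
  also have "distr M (S \<Otimes>\<^sub>M T) (\<lambda>\<omega>. (X \<omega>, Y \<omega>)) = distr M S X \<Otimes>\<^sub>M distr M T Y"
    using indep by (simp add: indep_var_distribution_eq)
  also have "emeasure \<dots> Q = (\<integral>\<^sup>+x. emeasure (distr M T Y) (Pair x -` Q) \<partial>distr M S X)"
    using Q by (intro Y.emeasure_pair_measure_alt) simp
  finally show ?thesis .
qed

locale sine_log_vector = prob_space M for M :: "'a measure" +
  fixes lam :: real and U V :: "'a \<Rightarrow> real" and X :: "'a \<Rightarrow> real ^ 2"
  assumes V [measurable]: "V \<in> borel_measurable M"
    and cdf_V: "\<And>u. 0 \<le> u \<Longrightarrow> u \<le> 1 \<Longrightarrow> cdf (distr M borel V) u = H lam u"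
    and U [measurable]: "U \<in> borel_measurable M"
    and distr_U: "distr M borel U = uniform_measure lborel {0<..<1}"
    and indep: "indep_var borel U borel V"
    and X_def: "X = (\<lambda>\<omega>. - (V \<omega> / 2) *\<^sub>R vector [1 / U \<omega>, 1 / (1 - U \<omega>)])"
begin

sublocale dV: real_distribution "distr M borel V"
  by simp

lemma X_nth: "X \<omega> $ 1 = - V \<omega> / (2 * U \<omega>)" "X \<omega> $ 2 = - V \<omega> / (2 * (1 - U \<omega>))"
  by (simp_all add: X_def)

lemma measurable_X [measurable]: "X \<in> borel_measurable M"
proof (rule borel_measurable_vecI)
  fix i :: 2
  show "(\<lambda>\<omega>. X \<omega> $ i) \<in> borel_measurable M"
    using exhaust_2[of i] by (elim disjE) (simp_all add: X_nth)
qed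

text \<open>The cdf is prescribed on the unit interval only; monotonicity and the values 0 and 1 at
  its ends settle the rest.\<close>

lemma cdf_V_eq: "cdf (distr M borel V) x = H lam (max 0 (min 1 x))"
proof -
  consider "x < 0" | "0 \<le> x" "x \<le> 1" | "1 < x" by linarith
  then show ?thesis
  proof cases
    case 1
    then show ?thesis
      using dV.cdf_nondecreasing[of x 0] dV.cdf_nonneg[of x] cdf_V[of 0] by simp
  next
    case 3
    then show ?thesis
      using dV.cdf_nondecreasing[of 1 x] dV.cdf_bounded_prob[of x] cdf_V[of 1] by simp
  qed (simp add: cdf_V)
qed

lemma measure_V_singleton: "measure (distr M borel V) {x} = 0"
proof -
  have "continuous_on UNIV (\<lambda>x. H lam (max 0 (min 1 x)))"
    by (intro continuous_on_compose2[OF continuous_on_H] continuous_intros) auto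
  then have "isCont (cdf (distr M borel V)) x"
    by (simp add: cdf_V_eq[abs_def] continuous_on_eq_continuous_at)
  then show ?thesis
    by (simp add: dV.isCont_cdf)
qed

lemma emeasure_V_lessThan: "emeasure (distr M borel V) {..<x} = cdf (distr M borel V) x"
proof -
  have "{..x} = {..<x} \<union> {x}"
    by auto
  then have "measure (distr M borel V) {..x} = measure (distr M borel V) ({..<x} \<union> {x})"
    by (simp only:)
  also have "\<dots> = measure (distr M borel V) {..<x}"
    by (subst dV.finite_measure_Union) (auto simp: measure_V_singleton)
  finally show ?thesis
    by (simp add: cdf_def dV.emeasure_eq_measure)
qed

text \<open>Given \<open>U\<close>, the variable \<open>V\<close> would have to hit one point, and
  it has no atoms.\<close>

lemma prob_V_eq_0:
  assumes [measurable]: "g \<in> borel_measurable borel"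
  shows "prob {\<omega>\<in>space M. V \<omega> = g (U \<omega>)} = 0"
proof -
  let ?Q = "{p. snd p = g (fst p)} :: (real \<times> real) set"
  have Q: "?Q \<in> sets (borel \<Otimes>\<^sub>M borel)"
  proof -
    have "{p \<in> space (borel \<Otimes>\<^sub>M borel). snd p = g (fst p)} \<in> sets (borel \<Otimes>\<^sub>M (borel :: real measure))"
      by measurable
    then show ?thesis by (simp add: space_pair_measure)
  qed
  have "emeasure M {\<omega>\<in>space M. (U \<omega>, V \<omega>) \<in> ?Q} =
      (\<integral>\<^sup>+u. emeasure (distr M borel V) (Pair u -` ?Q) \<partial>distr M borel U)"
    by (rule emeasure_indep_var[OF indep Q])
  also have "\<dots> = (\<integral>\<^sup>+u. 0 \<partial>distr M borel U)"
    by (intro nn_integral_cong) (simp add: vimage_def dV.emeasure_eq_measure measure_V_singleton)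
  finally show ?thesis
    by (simp add: measure_def)
qed

text \<open>Conditioning on \<open>U\<close> integrates the cdf of \<open>V\<close> at
  \<open>g u\<close>; since \<open>g\<close> stays in the unit interval, that cdf is
  \<open>H lam\<close>.\<close>

lemma prob_V_less:
  assumes [measurable]: "g \<in> borel_measurable borel"
    and g: "\<And>u. u \<in> {0..1} \<Longrightarrow> g u \<in> {0..1}"
    and int: "((\<lambda>u. H lam (g u)) has_integral I) {0..1}"
  shows "prob {\<omega>\<in>space M. V \<omega> < g (U \<omega>)} = I"
proof -
  let ?Q = "{p. snd p < g (fst p)} :: (real \<times> real) set"
  let ?F = "\<lambda>u. cdf (distr M borel V) (g u)"
  have F: "?F \<in> borel_measurable borel"
    by (rule measurable_compose[OF assms(1) borel_measurable_mono]) (auto intro!: monoI dV.cdf_nondecreasing)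
  have Q: "?Q \<in> sets (borel \<Otimes>\<^sub>M borel)"
  proof -
    have "{p \<in> space (borel \<Otimes>\<^sub>M borel). snd p < g (fst p)} \<in> sets (borel \<Otimes>\<^sub>M (borel :: real measure))"
      by measurable
    then show ?thesis by (simp add: space_pair_measure)
  qed
  have FH: "?F u = H lam (g u)" if "u \<in> {0..1}" for u
    using g[OF that] by (simp add: cdf_V)
  have int': "(?F has_integral I) {0..1}"
    using int by (rule has_integral_eq[rotated]) (simp add: FH)
  then have "I \<ge> 0"
    by (rule has_integral_nonneg) (simp add: dV.cdf_nonneg)
  have "emeasure M {\<omega>\<in>space M. (U \<omega>, V \<omega>) \<in> ?Q} =
      (\<integral>\<^sup>+u. emeasure (distr M borel V) (Pair u -` ?Q) \<partial>distr M borel U)"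
    by (rule emeasure_indep_var[OF indep Q])
  also have "\<dots> = (\<integral>\<^sup>+u. ennreal (?F u) \<partial>uniform_measure lborel {0<..<1})"
    unfolding distr_U by (intro nn_integral_cong) (simp add: vimage_def lessThan_def[symmetric] emeasure_V_lessThan)
  also have "\<dots> = (\<integral>\<^sup>+u. ennreal (?F u) * indicator {0<..<1} u \<partial>lborel)"
    using F by (subst nn_integral_uniform_measure) (auto simp: divide_ennreal_def)
  also have "\<dots> = (\<integral>\<^sup>+u. ennreal (?F u * indicator {0<..<1} u) \<partial>lborel)"
    by (intro nn_integral_cong) (auto simp: indicator_def)
  also have "\<dots> = ennreal I"
  proof (rule nn_integral_has_integral_lborel)
    show "(\<lambda>u. ?F u * indicator {0<..<1} u) \<in> borel_measurable borel"
      using F by measurable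
    have "(?F has_integral I) {0<..<1}"
      using int' by (simp add: has_integral_Icc_iff_Ioo)
    then have "((\<lambda>u. if u \<in> {0<..<1} then ?F u else 0) has_integral I) UNIV"
      by (simp only: has_integral_restrict_UNIV)
    then show "((\<lambda>u. ?F u * indicator {0<..<1} u) has_integral I) UNIV"
      by (rule has_integral_eq[rotated]) (auto simp: indicator_def)
  qed (simp add: dV.cdf_nonneg)
  finally show ?thesis
    using \<open>I \<ge> 0\<close> by (simp add: measure_def)
qed

lemma AE_U: "AE \<omega> in M. 0 < U \<omega> \<and> U \<omega> < 1"
proof -
  have "AE y in uniform_measure lborel {0<..<1::real}. 0 < y \<and> y < 1"
    by (rule AE_uniform_measureI) auto
  then have "AE y in distr M borel U. 0 < y \<and> y < 1"
    by (simp only: distr_U)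
  then show ?thesis
    by (subst (asm) AE_distr_iff) auto
qed

lemma AE_V_nonneg: "AE \<omega> in M. 0 \<le> V \<omega>"
proof -
  have "prob {\<omega>\<in>space M. V \<omega> < (\<lambda>u. 0) (U \<omega>)} = 0"
    by (rule prob_V_less) auto
  then show ?thesis
    by (subst (asm) prob_eq_0) (auto simp: not_less)
qed

lemma isCont_margin: "isCont (cdf (distr M borel (\<lambda>\<omega>. X \<omega> $ i))) x"
proof -
  \<comment> \<open>Solving \<open>X \<omega> $ i = x\<close> for \<open>V \<omega>\<close> gives
    \<open>g (U \<omega>)\<close>, so an atom of the margin would contradict
    \<open>prob_V_eq_0\<close>.\<close>
  define g where "g u = (if i = 1 then - 2 * x * u else - 2 * x * (1 - u))" for u :: real
  have meas: "(\<lambda>\<omega>. X \<omega> $ i) \<in> borel_measurable M"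
    by measurable
  interpret dX: real_distribution "distr M borel (\<lambda>\<omega>. X \<omega> $ i)"
    using meas by simp
  have "g \<in> borel_measurable borel"
    unfolding g_def by simp
  from prob_V_eq_0[OF this] have "AE \<omega> in M. V \<omega> \<noteq> g (U \<omega>)"
    using \<open>g \<in> borel_measurable borel\<close> by (subst (asm) prob_eq_0) auto
  with AE_U have "AE \<omega> in M. X \<omega> $ i \<noteq> x"
  proof eventually_elim
    case (elim \<omega>)
    then show ?case
      using exhaust_2[of i] by (auto simp: X_nth g_def field_simps)
  qed
  then have "prob {\<omega>\<in>space M. X \<omega> $ i = x} = 0"
    using meas by (subst prob_eq_0) auto
  then have "measure (distr M borel (\<lambda>\<omega>. X \<omega> $ i)) {x} = 0"
    using meas by (simp add: measure_distr vimage_def Int_def conj_commute)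
  then show ?thesis
    by (simp add: dX.isCont_cdf)
qed

text \<open>Up to a null set the event is the complement of \<open>V < g (U)\<close> with
  \<open>g u = 2 * max (u * a) ((1 - u) * b)\<close>. The bounds \<open>1 / 2\<close> keep
  \<open>g\<close> inside the unit interval.\<close>

lemma prob_X_le:
  assumes "0 \<le> a" "a \<le> 1 / 2" "0 \<le> b" "b \<le> 1 / 2"
  shows "prob {\<omega>\<in>space M. X \<omega> $ 1 \<le> - a \<and> X \<omega> $ 2 \<le> - b} =
    1 - (H_avg lam (2 * a) + H_avg lam (2 * b) - H_avg lam (2 * a * b / (a + b)))"
    (is "_ = 1 - ?I")
proof -
  define g where "g u = 2 * max (u * a) ((1 - u) * b)" for u
  have [measurable]: "g \<in> borel_measurable borel"
    unfolding g_def by measurable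
  have nth[measurable]: "(\<lambda>\<omega>. X \<omega> $ i) \<in> borel_measurable M" for i
    by measurable
  have g01: "g u \<in> {0..1}" if "u \<in> {0..1}" for u
    using that assms mult_mono[of u 1 a "1/2"] mult_mono[of "1-u" 1 b "1/2"]
    by (auto simp: g_def le_max_iff_disj)
  have "prob {\<omega>\<in>space M. V \<omega> < g (U \<omega>)} = ?I"
  proof (rule prob_V_less[OF _ g01])
    show "((\<lambda>u. H lam (g u)) has_integral ?I) {0..1}"
      unfolding g_def using assms by (intro has_integral_H_max) auto
  qed auto
  then have "prob {\<omega>\<in>space M. \<not> V \<omega> < g (U \<omega>)} = 1 - ?I"
    by (subst prob_neg) auto
  moreover have "prob {\<omega>\<in>space M. X \<omega> $ 1 \<le> - a \<and> X \<omega> $ 2 \<le> - b} = prob {\<omega>\<in>space M. \<not> V \<omega> < g (U \<omega>)}"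
  proof (rule finite_measure_eq_AE)
    show "AE \<omega> in M. \<omega> \<in> {\<omega>\<in>space M. X \<omega> $ 1 \<le> - a \<and> X \<omega> $ 2 \<le> - b} \<longleftrightarrow>
        \<omega> \<in> {\<omega>\<in>space M. \<not> V \<omega> < g (U \<omega>)}"
      using AE_U
    proof eventually_elim
      case (elim \<omega>)
      have "X \<omega> $ 1 \<le> - a \<longleftrightarrow> a \<le> V \<omega> / (2 * U \<omega>)"
        "X \<omega> $ 2 \<le> - b \<longleftrightarrow> b \<le> V \<omega> / (2 * (1 - U \<omega>))"
        by (simp_all only: X_nth minus_divide_left[symmetric] neg_le_iff_le)
      moreover have "0 < 2 * U \<omega>" "0 < 2 * (1 - U \<omega>)"
        using elim by auto
      ultimately have "X \<omega> $ 1 \<le> - a \<longleftrightarrow> a * (2 * U \<omega>) \<le> V \<omega>"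
        "X \<omega> $ 2 \<le> - b \<longleftrightarrow> b * (2 * (1 - U \<omega>)) \<le> V \<omega>"
        by (simp_all only: pos_le_divide_eq)
      moreover have "g (U \<omega>) \<le> V \<omega> \<longleftrightarrow> a * (2 * U \<omega>) \<le> V \<omega> \<and> b * (2 * (1 - U \<omega>)) \<le> V \<omega>"
        by (auto simp: g_def max_def algebra_simps)
      ultimately show ?case
        by (simp add: not_less)
    qed
  qed auto
  ultimately show ?thesis by simp
qed

text \<open>Both coordinates are almost surely nonpositive, so the margin is the joint probability
  with level 0 in the other coordinate; the mixed term then vanishes, for \<open>s = 0\<close>
  because \<open>0 / 0 = 0\<close>.\<close>

lemma margin_eq:
  assumes "0 \<le> s" "s \<le> 1 / 2"
  shows "cdf (distr M borel (\<lambda>\<omega>. X \<omega> $ i)) (- s) = 1 - H_avg lam (2 * s)"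
proof -
  have nth[measurable]: "(\<lambda>\<omega>. X \<omega> $ i) \<in> borel_measurable M" for i
    by measurable
  have neg: "AE \<omega> in M. X \<omega> $ 1 \<le> 0 \<and> X \<omega> $ 2 \<le> 0"
    using AE_U AE_V_nonneg by eventually_elim (auto simp: X_nth)
  define a b where "a = (if i = 1 then s else 0)" and "b = (if i = 1 then 0 else s)"
  have "cdf (distr M borel (\<lambda>\<omega>. X \<omega> $ i)) (- s) = prob {\<omega>\<in>space M. X \<omega> $ i \<le> - s}"
    by (simp add: cdf_def measure_distr vimage_def Int_def conj_commute)
  also have "\<dots> = prob {\<omega>\<in>space M. X \<omega> $ 1 \<le> - a \<and> X \<omega> $ 2 \<le> - b}"
  proof (rule finite_measure_eq_AE)
    show "AE \<omega> in M. \<omega> \<in> {\<omega>\<in>space M. X \<omega> $ i \<le> - s} \<longleftrightarrow>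
        \<omega> \<in> {\<omega>\<in>space M. X \<omega> $ 1 \<le> - a \<and> X \<omega> $ 2 \<le> - b}"
      using neg by eventually_elim (use exhaust_2[of i] in \<open>auto simp: a_def b_def\<close>)
  qed auto
  also have "\<dots> = 1 - H_avg lam (2 * s)"
    using assms by (subst prob_X_le) (auto simp: a_def b_def)
  finally show ?thesis .
qed

lemma is_copula_copula_of: "is_copula (copula_of M X)"
  by (rule copula_of_props(1)[OF measurable_X isCont_margin])

text \<open>Sklar's relation at \<open>- s\<close> with both sides explicit. Parametrizing by
  \<open>s\<close> avoids inverting \<open>H_avg\<close>.\<close>

lemma copula_of_eq:
  assumes "\<And>i. 0 \<le> s $ i \<and> s $ i \<le> 1 / 2"
  shows "copula_of M X (\<chi> i. 1 - H_avg lam (2 * s $ i)) =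
    1 - (H_avg lam (2 * s $ 1) + H_avg lam (2 * s $ 2) - H_avg lam (2 * s $ 1 * s $ 2 / (s $ 1 + s $ 2)))"
proof -
  have "copula_of M X (\<chi> i. 1 - H_avg lam (2 * s $ i)) =
      copula_of M X (\<chi> i. cdf (distr M borel (\<lambda>\<omega>. X \<omega> $ i)) ((- s) $ i))"
    using assms by (intro arg_cong[where f = "copula_of M X"]) (simp add: vec_eq_iff margin_eq)
  also have "\<dots> = measure (distr M borel X) {..- s}"
    by (rule copula_of_props(2)[OF measurable_X isCont_margin, symmetric])
  also have "\<dots> = prob {\<omega>\<in>space M. X \<omega> $ 1 \<le> - s $ 1 \<and> X \<omega> $ 2 \<le> - s $ 2}"
    by (simp add: measure_distr vimage_def Int_def conj_commute less_eq_vec_def forall_2)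
  also have "\<dots> = 1 - (H_avg lam (2 * s $ 1) + H_avg lam (2 * s $ 2) - H_avg lam (2 * s $ 1 * s $ 2 / (s $ 1 + s $ 2)))"
    using assms by (intro prob_X_le) auto
  finally show ?thesis .
qed

end

subsection \<open>The D-norm\<close>

definition harmonic_D_norm :: "real ^ 2 \<Rightarrow> real" where
  "harmonic_D_norm x = (if x = 0 then 0 else norm_1 x - \<bar>x $ 1\<bar> * \<bar>x $ 2\<bar> / norm_1 x)"

text \<open>The case distinction disappears because division by zero yields 0.\<close>

lemma harmonic_D_norm_eq:
  "harmonic_D_norm x = \<bar>x $ 1\<bar> + \<bar>x $ 2\<bar> - \<bar>x $ 1\<bar> * \<bar>x $ 2\<bar> / (\<bar>x $ 1\<bar> + \<bar>x $ 2\<bar>)"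
  by (auto simp: harmonic_D_norm_def norm_1_def sum_2)

text \<open>The norm is a maximum over \<open>u\<close> of nonnegative combinations of the \<open>\<bar>x\<^sub>i\<bar>\<close>, attained at
  \<open>u = \<bar>x\<^sub>2\<bar> / (\<bar>x\<^sub>1\<bar> + \<bar>x\<^sub>2\<bar>)\<close>; this gives the triangle inequality. The combination for \<open>u\<close> is
  the expectation of \<open>2 * U * \<bar>x\<^sub>1\<bar>\<close> on \<open>U \<ge> u\<close> and \<open>2 * (1 - U) * \<bar>x\<^sub>2\<bar>\<close> on \<open>U < u\<close>.\<close>

lemma harmonic_D_norm_ge:
  "\<bar>x $ 1\<bar> * (1 - u\<^sup>2) + \<bar>x $ 2\<bar> * (1 - (1 - u)\<^sup>2) \<le> harmonic_D_norm x"
proof (cases "x = 0")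
  case False
  define a b where "a = \<bar>x $ 1\<bar>" and "b = \<bar>x $ 2\<bar>"
  have ab: "0 < a + b"
    using False by (auto simp: a_def b_def vec_eq_iff forall_2)
  \<comment> \<open>Completing the square in \<open>u\<close>; the gap closes exactly at
    \<open>u = b / (a + b)\<close>.\<close>
  have "a + b - a * b / (a + b) - (a * (1 - u\<^sup>2) + b * (1 - (1 - u)\<^sup>2)) = (a * u - b * (1 - u))\<^sup>2 / (a + b)"
    using ab by (simp add: field_simps power2_eq_square)
  also have "\<dots> \<ge> 0"
    using ab by simp
  finally show ?thesis
    by (simp add: harmonic_D_norm_eq a_def b_def)
qed (simp add: harmonic_D_norm_def)

lemma harmonic_D_norm_attained:
  obtains u where "0 \<le> u" "u \<le> 1"
    "harmonic_D_norm x = \<bar>x $ 1\<bar> * (1 - u\<^sup>2) + \<bar>x $ 2\<bar> * (1 - (1 - u)\<^sup>2)"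
proof (cases "x = 0")
  case True
  then show ?thesis by (intro that[of 0]) (auto simp: harmonic_D_norm_def)
next
  case False
  define a b where "a = \<bar>x $ 1\<bar>" and "b = \<bar>x $ 2\<bar>"
  have ab: "0 < a + b" "0 \<le> a" "0 \<le> b"
    using False by (auto simp: a_def b_def vec_eq_iff forall_2)
  define u where "u = b / (a + b)"
  have "a * u - b * (1 - u) = 0"
    using ab by (simp add: u_def field_simps)
  moreover have "a + b - a * b / (a + b) - (a * (1 - u\<^sup>2) + b * (1 - (1 - u)\<^sup>2)) = (a * u - b * (1 - u))\<^sup>2 / (a + b)"
    using ab by (simp add: field_simps power2_eq_square)
  ultimately have "a + b - a * b / (a + b) = a * (1 - u\<^sup>2) + b * (1 - (1 - u)\<^sup>2)"
    by simp
  moreover have "0 \<le> u" "u \<le> 1"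
    using ab by (auto simp: u_def)
  ultimately show ?thesis
    by (intro that[of u]) (simp_all add: harmonic_D_norm_eq a_def b_def)
qed

lemma is_norm_harmonic_D_norm: "is_norm harmonic_D_norm"
  unfolding is_norm_def
proof (intro conjI allI)
  fix x y :: "real ^ 2" and c :: real
  \<comment> \<open>At \<open>u = 1 / 2\<close> both weights equal \<open>3 / 4\<close>; this
    comparison with the 1-norm gives nonnegativity and definiteness.\<close>
  have ge: "(\<bar>x $ 1\<bar> + \<bar>x $ 2\<bar>) * (3 / 4) \<le> harmonic_D_norm x"
    using harmonic_D_norm_ge[of x "1/2"] by (simp add: power2_eq_square algebra_simps)
  show nonneg: "0 \<le> harmonic_D_norm x"
    using ge by (rule order_trans[rotated]) simp
  show "harmonic_D_norm x = 0 \<longleftrightarrow> x = 0"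
  proof
    assume "harmonic_D_norm x = 0"
    then have "\<bar>x $ 1\<bar> + \<bar>x $ 2\<bar> \<le> 0"
      using ge by simp
    then have "x $ 1 = 0" "x $ 2 = 0"
      by linarith+
    then show "x = 0"
      by (simp add: vec_eq_iff forall_2)
  qed (simp add: harmonic_D_norm_def)
  show "harmonic_D_norm (c *\<^sub>R x) = \<bar>c\<bar> * harmonic_D_norm x"
    by (cases "c = 0") (auto simp: harmonic_D_norm_eq abs_mult right_diff_distrib distrib_left[symmetric])
  \<comment> \<open>The \<open>u\<close> that is optimal for \<open>x + y\<close> is merely
    admissible for \<open>x\<close> and for \<open>y\<close>, and its weights are
    nonnegative.\<close>
  obtain u where u: "0 \<le> u" "u \<le> 1"
    "harmonic_D_norm (x + y) = \<bar>(x + y) $ 1\<bar> * (1 - u\<^sup>2) + \<bar>(x + y) $ 2\<bar> * (1 - (1 - u)\<^sup>2)"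
    by (rule harmonic_D_norm_attained)
  have "\<bar>(x + y) $ 1\<bar> * (1 - u\<^sup>2) \<le> (\<bar>x $ 1\<bar> + \<bar>y $ 1\<bar>) * (1 - u\<^sup>2)"
    using u by (intro mult_right_mono) (auto simp: power_le_one)
  moreover have "\<bar>(x + y) $ 2\<bar> * (1 - (1 - u)\<^sup>2) \<le> (\<bar>x $ 2\<bar> + \<bar>y $ 2\<bar>) * (1 - (1 - u)\<^sup>2)"
    using u by (intro mult_right_mono) (auto simp: power_le_one)
  ultimately show "harmonic_D_norm (x + y) \<le> harmonic_D_norm x + harmonic_D_norm y"
    using harmonic_D_norm_ge[of x u] harmonic_D_norm_ge[of y u] unfolding u(3) distrib_right by linarith
qed

text \<open>\<open>C\<close> itself witnesses that \<open>N\<close> is a D-norm: close to 1 the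
  remainder is identically zero.\<close>

lemma is_GPC_I:
  fixes N :: "real ^ 'd \<Rightarrow> real"
  assumes C: "is_copula C" and N: "is_norm N"
    and v: "\<And>i. 0 \<le> v $ i \<and> v $ i < 1"
    and eq: "\<And>u. v \<le> u \<Longrightarrow> u \<le> 1 \<Longrightarrow> C u = 1 - N (u - 1)"
  shows "is_GPC C N"
proof -
  have "eventually (\<lambda>u. \<forall>i. v $ i < u $ i) (at 1 within {0..1})"
    using v by (intro eventually_all_finite order_tendstoD(1)[OF tendsto_vec_nth[OF tendsto_ident_at]]) auto
  moreover have "eventually (\<lambda>u. u \<in> {0..1}) (at (1 :: real ^ 'd) within {0..1})"
    by (simp add: eventually_at_filter)
  ultimately have "eventually (\<lambda>u. C u - (1 - N (u - 1)) = 0) (at 1 within {0..1})"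
    by eventually_elim (simp add: eq less_eq_vec_def less_imp_le)
  then have "(\<lambda>u. C u - (1 - N (u - 1))) \<in> o[at 1 within {0..1}](\<lambda>u. N (u - 1))"
    by (subst landau_o.small.in_cong[where g = "\<lambda>_. 0"]) auto
  with C N v eq show ?thesis
    unfolding is_GPC_def is_D_norm_def by blast
qed

subsection \<open>Oscillation of the averages\<close>

lemma abs_le_sqrt2_half_bound:
  fixes lam :: real
  assumes "\<bar>lam\<bar> \<le> sqrt 2 / 2" shows "\<bar>lam\<bar> \<le> 0.7072"
proof -
  have "sqrt 2 \<le> sqrt (1.4144\<^sup>2 :: real)"
    by (intro real_sqrt_le_mono) (simp add: power2_eq_square)
  then show ?thesis using assms by simp
qed

lemma abs_three_sin_plus_cos_le: "\<bar>3 * sin x + cos x\<bar> \<le> (3.2::real)"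
proof -
  have "(3 * s + c)\<^sup>2 + (s - 3 * c)\<^sup>2 = 10 * (s\<^sup>2 + c\<^sup>2)" for s c :: real
    by (simp add: power2_eq_square algebra_simps)
  from this[of "sin x" "cos x"] have "(3 * sin x + cos x)\<^sup>2 \<le> 10"
    using zero_le_power2[of "sin x - 3 * cos x"] unfolding sin_cos_squared_add by linarith
  also have "10 \<le> (3.2::real)\<^sup>2"
    by (simp add: power2_eq_square)
  finally have "(3 * sin x + cos x)\<^sup>2 \<le> 3.2\<^sup>2" .
  then show ?thesis
    by (simp only: abs_le_square_iff[symmetric])
qed

text \<open>The derivative is \<open>1 / 2\<close> plus a perturbation of size at most
  \<open>0.7072 / 5 * 3.2\<close>, which is below \<open>1 / 2\<close>; the decimals bound
  \<open>sqrt 2 / 2\<close> and \<open>sqrt 10\<close> from above.\<close>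

lemma H_avg_strict_mono:
  assumes lam: "\<bar>lam\<bar> \<le> sqrt 2 / 2" and "0 \<le> s" "s < t"
  shows "H_avg lam s < H_avg lam t"
proof (rule DERIV_pos_imp_increasing_open[OF \<open>s < t\<close>])
  show "continuous_on {s..t} (H_avg lam)"
    using assms by (intro continuous_on_subset[OF continuous_on_H_avg]) auto
  fix x assume "s < x"
  then have x: "0 < x" using assms by simp
  let ?d = "1 / 2 + lam / 5 * (3 * sin (ln x) + cos (ln x))"
  have "(H_avg lam has_real_derivative ?d) (at x)"
    unfolding H_avg_def[abs_def] using x
    by (auto intro!: derivative_eq_intros simp: field_simps)
  moreover have "\<bar>lam / 5 * (3 * sin (ln x) + cos (ln x))\<bar> \<le> 0.7072 / 5 * 3.2"
    unfolding abs_mult using abs_le_sqrt2_half_bound[OF lam]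
    by (intro mult_mono abs_three_sin_plus_cos_le) auto
  then have "?d > 0"
    by (simp only: abs_le_iff) simp
  ultimately show "\<exists>y. (H_avg lam has_real_derivative y) (at x) \<and> 0 < y"
    by blast
qed

lemma H_avg_pos:
  assumes "\<bar>lam\<bar> \<le> sqrt 2 / 2" "0 < t"
  shows "0 < H_avg lam t"
  using H_avg_strict_mono[OF assms(1), of 0 t] assms(2) by simp

text \<open>Taking logarithms, \<open>n * ln (1 - a n / n)\<close> equals \<open>- a n\<close> up to
  an error of at most \<open>2 * K\<^sup>2 / n\<close>.\<close>

lemma tendsto_of_one_minus_power:
  fixes a :: "nat \<Rightarrow> real"
  assumes lim: "(\<lambda>n. (1 - a n / real n) ^ n) \<longlonglongrightarrow> g"
    and a: "eventually (\<lambda>n. 0 \<le> a n \<and> a n \<le> K) sequentially"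
  shows "a \<longlonglongrightarrow> - ln g"
proof -
  have "(\<lambda>n. K / real n) \<longlonglongrightarrow> 0"
    by real_asymp
  then have "eventually (\<lambda>n. K / real n < 1 / 2) sequentially"
    by (rule order_tendstoD) simp
  with eventually_gt_at_top[of 0]
  have large: "eventually (\<lambda>n. 0 < n \<and> K / real n \<le> 1 / 2) sequentially"
    by eventually_elim simp
  \<comment> \<open>The upper bound on \<open>a\<close> keeps the limit away from 0, so
    \<open>ln\<close> is continuous there.\<close>
  have "exp (- K) \<le> g"
  proof (rule tendsto_le[OF _ lim tendsto_exp_limit_sequentially])
    show "eventually (\<lambda>n. (1 + - K / real n) ^ n \<le> (1 - a n / real n) ^ n) sequentially"
      using a large
      by eventually_elim (intro power_mono, auto simp: divide_right_mono)
  qed simp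
  then have "0 < g"
    using exp_gt_zero[of "- K"] by linarith
  have "(\<lambda>n. ln ((1 - a n / real n) ^ n)) \<longlonglongrightarrow> ln g"
    using \<open>0 < g\<close> by (intro tendsto_ln lim) auto
  moreover have "(\<lambda>n. ln ((1 - a n / real n) ^ n) + a n) \<longlonglongrightarrow> 0"
  proof (rule Lim_null_comparison)
    show "eventually (\<lambda>n. norm (ln ((1 - a n / real n) ^ n) + a n) \<le> 2 * K\<^sup>2 / real n) sequentially"
      using a large
    proof eventually_elim
      case (elim n)
      have 0: "0 \<le> a n / real n" "a n / real n \<le> K / real n"
        using elim by (auto simp: divide_right_mono)
      have "\<bar>ln (1 + - (a n / real n)) - - (a n / real n)\<bar> \<le> 2 * (- (a n / real n))\<^sup>2"
        using 0 elim by (intro abs_ln_one_plus_x_minus_x_bound) auto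
      also have "\<dots> \<le> 2 * (K / real n)\<^sup>2"
        using 0 by (auto intro!: power_mono)
      finally have "real n * \<bar>ln (1 - a n / real n) + a n / real n\<bar> \<le> real n * (2 * (K / real n)\<^sup>2)"
        by (intro mult_left_mono) auto
      also have "real n * (2 * (K / real n)\<^sup>2) = 2 * K\<^sup>2 / real n"
        using elim by (simp add: field_simps power2_eq_square)
      also have "real n * \<bar>ln (1 - a n / real n) + a n / real n\<bar> = \<bar>real n * (ln (1 - a n / real n) + a n / real n)\<bar>"
        by (simp add: abs_mult)
      also have "real n * (ln (1 - a n / real n) + a n / real n) = ln ((1 - a n / real n) ^ n) + a n"
        using 0 elim by (simp add: ln_realpow distrib_left)
      finally show ?case by simp
    qed
    show "(\<lambda>n. 2 * K\<^sup>2 / real n) \<longlonglongrightarrow> 0"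
      by real_asymp
  qed
  ultimately have "(\<lambda>n. (ln ((1 - a n / real n) ^ n) + a n) - ln ((1 - a n / real n) ^ n)) \<longlonglongrightarrow> 0 - ln g"
    by (rule tendsto_diff[rotated])
  then show ?thesis by simp
qed

text \<open>The points \<open>\<tau> n\<close> are dense enough near 0: if \<open>1 / (n + 1) < H_avg lam x \<le> 1 / n\<close>, then \<open>x\<close>
  lies between \<open>\<tau> (n + 1)\<close> and \<open>\<tau> n\<close>, so monotonicity transfers the limit from \<open>\<tau>\<close> to every
  null sequence.\<close>

lemma H_avg_ratio_tendsto:
  assumes lam: "\<bar>lam\<bar> \<le> sqrt 2 / 2"
    and \<tau>: "eventually (\<lambda>n. 0 < \<tau> n \<and> H_avg lam (\<tau> n) = 1 / real n) sequentially"
    and lim: "(\<lambda>n. real n * H_avg lam (\<tau> n / 2)) \<longlonglongrightarrow> l"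
    and z: "\<And>k. 0 < z k" "z \<longlonglongrightarrow> 0"
  shows "(\<lambda>k. H_avg lam (z k / 2) / H_avg lam (z k)) \<longlonglongrightarrow> l"
proof -
  let ?B = "H_avg lam"
  \<comment> \<open>This choice puts \<open>?B (z k)\<close> above \<open>1 / (n k + 1)\<close> and,
    once \<open>n k\<close> is positive, at or below \<open>1 / n k\<close>.\<close>
  define n where "n k = nat \<lfloor>1 / ?B (z k)\<rfloor>" for k :: nat
  have pos: "0 < ?B (z k)" for k
    using H_avg_pos[OF lam z(1)] .
  have mono: "?B s \<le> ?B t" if "0 \<le> s" "s \<le> t" for s t
    using H_avg_strict_mono[OF lam \<open>0 \<le> s\<close>, of t] that by (cases "s = t") auto
  have le: "s \<le> t" if "?B s \<le> ?B t" "0 \<le> t" for s t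
    using that H_avg_strict_mono[OF lam, of t s] by (cases "s \<le> t") auto
  have "(?B \<longlongrightarrow> ?B 0) (at 0 within {0..})"
    using continuous_on_H_avg[of lam] unfolding continuous_on_def by (rule bspec) simp
  moreover have "filterlim z (at 0 within {0..}) sequentially"
    using z by (auto simp: filterlim_at less_imp_le less_imp_neq[THEN not_sym])
  ultimately have B0: "(\<lambda>k. ?B (z k)) \<longlonglongrightarrow> 0"
    by (auto dest: filterlim_compose)
  have n: "filterlim n at_top sequentially"
    unfolding filterlim_at_top
  proof
    fix m :: nat
    have "eventually (\<lambda>k. ?B (z k) < 1 / (real m + 1)) sequentially"
      by (rule order_tendstoD(2)[OF B0]) simp
    then show "eventually (\<lambda>k. m \<le> n k) sequentially"
    proof eventually_elim
      case (elim k)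
      then have "real m \<le> 1 / ?B (z k)"
        using pos[of k] by (simp add: field_simps)
      then show ?case
        unfolding n_def by (simp add: le_nat_floor)
    qed
  qed
  have \<tau>_Suc: "eventually (\<lambda>n. 0 < \<tau> (Suc n) \<and> ?B (\<tau> (Suc n)) = 1 / real (Suc n)) sequentially"
    using \<tau> by (rule eventually_sequentially_Suc[THEN iffD2])
  \<comment> \<open>Here \<open>1 / ?B x\<close> lies between \<open>m\<close> and
    \<open>m + 1\<close>, and \<open>?B (x / 2)\<close> between the values at
    \<open>\<tau> (Suc m) / 2\<close> and \<open>\<tau> m / 2\<close>.\<close>
  have sq: "eventually (\<lambda>m. \<forall>x>0. 1 / (real m + 1) < ?B x \<and> ?B x \<le> 1 / real m \<longrightarrow>
      real m * ?B (\<tau> (Suc m) / 2) \<le> ?B (x / 2) / ?B x \<and>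
      ?B (x / 2) / ?B x \<le> (real m + 1) * ?B (\<tau> m / 2)) sequentially"
    using \<tau> \<tau>_Suc eventually_gt_at_top[of 0]
  proof eventually_elim
    case (elim m)
    show ?case
    proof (intro allI impI)
      fix x assume x: "0 < x" "1 / (real m + 1) < ?B x \<and> ?B x \<le> 1 / real m"
      have \<tau>_pos: "0 < \<tau> m" "0 < \<tau> (Suc m)"
        and \<tau>_eq: "?B (\<tau> m) = 1 / real m" "?B (\<tau> (Suc m)) = 1 / (real m + 1)"
        using elim by (simp_all add: add.commute)
      have "\<tau> (Suc m) \<le> x"
        by (rule le) (use x in \<open>simp_all add: \<tau>_eq\<close>)
      moreover have "x \<le> \<tau> m"
        by (rule le) (use x \<tau>_pos in \<open>simp_all add: \<tau>_eq\<close>)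
      ultimately have le': "?B (\<tau> (Suc m) / 2) \<le> ?B (x / 2)" "?B (x / 2) \<le> ?B (\<tau> m / 2)"
        using x(1) \<tau>_pos by (simp_all add: mono)
      have Bx: "0 < ?B x" "real m * ?B x \<le> 1" "1 \<le> (real m + 1) * ?B x"
        using x elim(3) H_avg_pos[OF lam x(1)] by (simp_all add: field_simps)
      have B2: "0 < ?B (\<tau> (Suc m) / 2)" "0 < ?B (\<tau> m / 2)"
        using \<tau>_pos by (simp_all add: H_avg_pos[OF lam])
      have "real m * ?B x * ?B (\<tau> (Suc m) / 2) \<le> 1 * ?B (x / 2)"
        using Bx B2 le' by (intro mult_mono) auto
      moreover have "1 * ?B (x / 2) \<le> (real m + 1) * ?B x * ?B (\<tau> m / 2)"
        using Bx B2 le' by (intro mult_mono) auto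
      ultimately show "real m * ?B (\<tau> (Suc m) / 2) \<le> ?B (x / 2) / ?B x \<and>
          ?B (x / 2) / ?B x \<le> (real m + 1) * ?B (\<tau> m / 2)"
        using Bx by (simp add: pos_le_divide_eq pos_divide_le_eq ac_simps)
    qed
  qed
  have bounds: "1 / (real (n k) + 1) < ?B (z k) \<and> (0 < n k \<longrightarrow> ?B (z k) \<le> 1 / real (n k))" for k
  proof -
    have "real (n k) = of_int \<lfloor>1 / ?B (z k)\<rfloor>"
      using pos[of k] by (simp add: n_def)
    then have "real (n k) \<le> 1 / ?B (z k)" "1 / ?B (z k) < real (n k) + 1"
      by linarith+
    then show ?thesis
      using pos[of k] by (simp add: field_simps)
  qed
  have sq': "eventually (\<lambda>k. real (n k) * ?B (\<tau> (Suc (n k)) / 2) \<le> ?B (z k / 2) / ?B (z k) \<and>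
      ?B (z k / 2) / ?B (z k) \<le> (real (n k) + 1) * ?B (\<tau> (n k) / 2)) sequentially"
    using eventually_compose_filterlim[OF sq n] eventually_compose_filterlim[OF eventually_gt_at_top[of 0] n]
    by eventually_elim (use bounds z(1) in auto)
  \<comment> \<open>In both bounds the factor is off by one from the index of \<open>\<tau>\<close>;
    the correcting quotient tends to 1.\<close>
  have "(\<lambda>m. real m / (real m + 1) * (real (Suc m) * ?B (\<tau> (Suc m) / 2))) \<longlonglongrightarrow> 1 * l"
    by (intro tendsto_mult LIMSEQ_Suc[OF lim]) real_asymp
  moreover have "real m / (real m + 1) * (real (Suc m) * x) = real m * x" for m x
    by (simp add: field_simps)
  ultimately have low: "(\<lambda>m. real m * ?B (\<tau> (Suc m) / 2)) \<longlonglongrightarrow> l"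
    by simp
  have "(\<lambda>m. (real m + 1) / real m * (real m * ?B (\<tau> m / 2))) \<longlonglongrightarrow> 1 * l"
    by (intro tendsto_mult lim) real_asymp
  moreover have "eventually (\<lambda>m. (real m + 1) / real m * (real m * ?B (\<tau> m / 2)) = (real m + 1) * ?B (\<tau> m / 2)) sequentially"
    using eventually_gt_at_top[of 0] by eventually_elim simp
  ultimately have up: "(\<lambda>m. (real m + 1) * ?B (\<tau> m / 2)) \<longlonglongrightarrow> l"
    by (simp add: filterlim_cong)
  show ?thesis
    by (rule tendsto_sandwich[OF _ _ filterlim_compose[OF low n] filterlim_compose[OF up n]])
      (use sq' in \<open>auto elim: eventually_mono\<close>)
qed

text \<open>Along \<open>exp (x - 2 * k * pi)\<close> the ratio does not depend on \<open>k\<close>, so its limit being independent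
  of \<open>x\<close> forces a relation between a trigonometric polynomial and its shift by \<open>ln 2\<close>.\<close>

lemma H_avg_ratio_convergent_imp:
  assumes "\<bar>lam\<bar> \<le> sqrt 2 / 2"
    and lim: "\<And>z. (\<And>k. 0 < z k) \<Longrightarrow> z \<longlonglongrightarrow> 0 \<Longrightarrow> (\<lambda>k. H_avg lam (z k / 2) / H_avg lam (z k)) \<longlonglongrightarrow> l"
  shows "lam = 0"
proof (rule ccontr)
  assume "lam \<noteq> 0"
  define q where "q x = 1 / 2 + lam / 5 * (2 * sin x - cos x)" for x
  have periodic: "q (x - 2 * real k * pi) = q x" for x and k :: nat
    by (simp add: q_def sin_diff cos_diff del: mult.assoc)
  have H_avg_q: "H_avg lam t = t * q (ln t)" for t
    by (simp add: H_avg_eq q_def)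
  have q_pos: "0 < q x" for x
    using H_avg_pos[OF assms(1), of "exp x"] by (simp add: H_avg_q zero_less_mult_iff)
  have q_eq: "q (x - ln 2) = 2 * l * q x" for x
  proof -
    let ?z = "\<lambda>k::nat. exp (x - 2 * real k * pi)"
    have "?z \<longlonglongrightarrow> 0"
      by real_asymp
    then have "(\<lambda>k. H_avg lam (?z k / 2) / H_avg lam (?z k)) \<longlonglongrightarrow> l"
      by (intro lim) auto
    moreover have "H_avg lam (?z k / 2) / H_avg lam (?z k) = q (x - ln 2) / (2 * q x)" for k
    proof -
      have "q (ln (?z k / 2)) = q (x - ln 2 - 2 * real k * pi)"
        by (simp add: ln_div algebra_simps)
      then show ?thesis
        by (simp add: H_avg_q periodic)
    qed
    ultimately have "q (x - ln 2) / (2 * q x) = l"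
      by (simp add: LIMSEQ_const_iff)
    then show ?thesis
      using q_pos[of x] by (simp add: field_simps)
  qed
  \<comment> \<open>A shift by \<open>pi\<close> flips the signs of sine and cosine, so the
    oscillating parts cancel. Applying \<open>q_eq\<close> to such a sum forces
    \<open>2 * l = 1\<close>.\<close>
  have "q (0 + pi) + q 0 = 1" "q (0 - ln 2 + pi) + q (0 - ln 2) = 1"
    by (simp_all only: q_def sin_periodic_pi cos_periodic_pi) (simp_all add: algebra_simps)
  moreover have "0 - ln 2 + pi = (0 + pi) - ln (2::real)" by simp
  ultimately have "1 = 2 * l * (q (0 + pi) + q 0)" "q (0 + pi) + q 0 = 1"
    unfolding distrib_left by (simp_all only: q_eq)
  then have "2 * l = 1" by simp
  \<comment> \<open>Now \<open>q\<close> is invariant under the shift by \<open>ln 2\<close>;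
    comparing it at \<open>- ln 2\<close>, 0 and \<open>ln 2\<close> yields
    \<open>sin (ln 2) = 0\<close>, although \<open>ln 2\<close> lies strictly between 0 and
    \<open>pi\<close>.\<close>
  then have "q (0 - ln 2) = q 0" "q (ln 2 - ln 2) = q (ln 2)"
    using q_eq[of 0] q_eq[of "ln 2"] by simp_all
  then have "2 * sin (ln 2) + cos (ln 2) = (1::real)" "cos (ln 2) - 2 * sin (ln 2) = (1::real)"
    using \<open>lam \<noteq> 0\<close> by (auto simp: q_def)
  then have "sin (ln 2 :: real) = 0"
    by linarith
  moreover have "0 < sin (ln 2 :: real)"
    using ln_less_self[of 2] pi_ge_two by (intro sin_gt_zero) (simp, linarith)
  ultimately show False by simp
qed

section \<open>The two claims about the copula of \<open>X\<close>\<close>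

context sine_log_vector
begin

text \<open>Attraction is tested in the direction \<open>- 1\<close>. There the copula is
  \<open>1 - a n / n\<close> with \<open>a n = 2 - n * H_avg lam (\<tau> n / 2)\<close>, so
  convergence of the powers becomes convergence of \<open>a\<close>.\<close>

lemma copula_of_not_in_domain_of_attraction:
  assumes lam: "\<bar>lam\<bar> \<le> sqrt 2 / 2" and G: "in_domain_of_attraction (copula_of M X) G"
  shows "lam = 0"
proof -
  let ?B = "H_avg lam"
  \<comment> \<open>The threshold 3 comes from \<open>?B 1 = 1 / 2 - lam / 5\<close>, which is at
    least \<open>1 / 3\<close>; \<open>t \<le> 1\<close> is the range in which the copula is
    known.\<close>
  have "\<exists>t. 0 < t \<and> t \<le> 1 \<and> ?B t = 1 / real n" if n: "3 \<le> n" for n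
  proof -
    have "1 / real n \<le> 1 / 3"
      using n by (simp add: frac_le)
    moreover have "1 / 3 \<le> ?B 1"
      using abs_le_sqrt2_half_bound[OF lam] by (simp add: H_avg_def abs_le_iff)
    ultimately obtain t where t: "0 \<le> t" "t \<le> 1" "?B t = 1 / real n"
      using IVT'[of ?B 0 "1 / real n" 1] continuous_on_subset[OF continuous_on_H_avg, of "{0..1}" lam] by auto
    moreover have "t \<noteq> 0"
      using t(3) n by auto
    ultimately have "0 < t \<and> t \<le> 1 \<and> ?B t = 1 / real n" by simp
    then show ?thesis ..
  qed
  then obtain \<tau> where \<tau>: "\<And>n. 3 \<le> n \<Longrightarrow> 0 < \<tau> n \<and> \<tau> n \<le> 1 \<and> ?B (\<tau> n) = 1 / real n"
    by metis
  define a where "a n = 2 - real n * ?B (\<tau> n / 2)" for n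
  have C: "copula_of M X (1 + (1 / real n) *\<^sub>R (- 1)) = 1 - a n / real n" if "3 \<le> n" for n
  proof -
    define s :: "real ^ 2" where "s = (\<chi> i. \<tau> n / 2)"
    have s: "s $ i = \<tau> n / 2" for i
      by (simp add: s_def)
    have "1 + (1 / real n) *\<^sub>R (- 1 :: real ^ 2) = (\<chi> i. 1 - ?B (2 * s $ i))"
      using \<tau>[OF that] by (simp add: vec_eq_iff s)
    moreover have "copula_of M X (\<chi> i. 1 - ?B (2 * s $ i)) =
        1 - (?B (2 * s $ 1) + ?B (2 * s $ 2) - ?B (2 * s $ 1 * s $ 2 / (s $ 1 + s $ 2)))"
      using \<tau>[OF that] by (intro copula_of_eq) (simp add: s)
    moreover have "?B (2 * s $ i) = 1 / real n" for i
      using \<tau>[OF that] by (simp add: s)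
    moreover have "?B (2 * s $ 1 * s $ 2 / (s $ 1 + s $ 2)) = ?B (\<tau> n / 2)"
      using \<tau>[OF that] by (simp add: s)
    ultimately have "copula_of M X (1 + (1 / real n) *\<^sub>R (- 1)) = 1 - (1 / real n + 1 / real n - ?B (\<tau> n / 2))"
      by (simp only:)
    then show ?thesis
      using that by (simp add: a_def diff_divide_distrib)
  qed
  have "(\<lambda>n. copula_of M X (1 + (1 / real n) *\<^sub>R (- 1)) ^ n) \<longlonglongrightarrow> G (- 1)"
    using G unfolding in_domain_of_attraction_def by (simp add: less_eq_vec_def del: scaleR_minus_right)
  moreover have "eventually (\<lambda>n. copula_of M X (1 + (1 / real n) *\<^sub>R (- 1)) ^ n = (1 - a n / real n) ^ n) sequentially"
    using eventually_ge_at_top[of 3] by eventually_elim (simp only: C)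
  ultimately have "(\<lambda>n. (1 - a n / real n) ^ n) \<longlonglongrightarrow> G (- 1)"
    by (simp only: filterlim_cong)
  moreover have "eventually (\<lambda>n. 0 \<le> a n \<and> a n \<le> 2) sequentially"
    using eventually_ge_at_top[of 3]
  proof eventually_elim
    case (elim n)
    have "?B (\<tau> n / 2) < ?B (\<tau> n)"
      by (rule H_avg_strict_mono[OF lam]) (use \<tau>[OF elim] in auto)
    moreover have "0 < ?B (\<tau> n / 2)"
      by (rule H_avg_pos[OF lam]) (use \<tau>[OF elim] in auto)
    ultimately have "0 \<le> real n * ?B (\<tau> n / 2)" "real n * ?B (\<tau> n / 2) \<le> 1"
      using \<tau>[OF elim] elim by (auto simp: field_simps)
    then show ?case
      by (simp add: a_def)
  qed
  ultimately have "a \<longlonglongrightarrow> - ln (G (- 1))"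
    by (rule tendsto_of_one_minus_power)
  then have "(\<lambda>n. 2 - a n) \<longlonglongrightarrow> 2 - - ln (G (- 1))"
    by (intro tendsto_intros)
  then have lim: "(\<lambda>n. real n * ?B (\<tau> n / 2)) \<longlonglongrightarrow> 2 - - ln (G (- 1))"
    by (simp add: a_def)
  have \<tau>_ev: "eventually (\<lambda>n. 0 < \<tau> n \<and> ?B (\<tau> n) = 1 / real n) sequentially"
    using eventually_ge_at_top[of 3] by eventually_elim (use \<tau> in auto)
  show ?thesis
    by (rule H_avg_ratio_convergent_imp[OF lam H_avg_ratio_tendsto[OF lam \<tau>_ev lim]])
qed

text \<open>For \<open>lam = 0\<close> the margin at \<open>- s\<close> is \<open>1 - s\<close>, so
  \<open>s = 1 - u\<close> is the parameter belonging to \<open>u\<close>; the range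
  \<open>s \<le> 1 / 2\<close> gives the corner \<open>1 / 2\<close>.\<close>

lemma is_GPC_copula_of:
  assumes "lam = 0"
  shows "is_GPC (copula_of M X) harmonic_D_norm"
proof (rule is_GPC_I[OF is_copula_copula_of is_norm_harmonic_D_norm, where v = "\<chi> i. 1 / 2"])
  fix u :: "real ^ 2" assume u: "(\<chi> i. 1 / 2) \<le> u" "u \<le> 1"
  then have u': "1 / 2 \<le> u $ i" "u $ i \<le> 1" for i
    by (auto simp: less_eq_vec_def)
  have "(\<chi> i. 1 - H_avg lam (2 * (1 - u) $ i)) = u"
    using assms by (simp add: vec_eq_iff diff_divide_distrib)
  then have "copula_of M X u = 1 - (H_avg lam (2 * (1 - u) $ 1) + H_avg lam (2 * (1 - u) $ 2)
      - H_avg lam (2 * (1 - u) $ 1 * (1 - u) $ 2 / ((1 - u) $ 1 + (1 - u) $ 2)))"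
    using copula_of_eq[of "1 - u"] u' by simp
  moreover have "\<bar>(u - 1) $ i\<bar> = (1 - u) $ i" for i
    using u'[of i] by simp
  moreover have "2 * a / 2 + 2 * b / 2 - 2 * a * b / (a + b) / 2 = a + b - a * b / (a + b)" for a b :: real
  proof -
    have "2 * (a * b / (a + b)) / 2 = a * b / (a + b)"
      by (rule nonzero_mult_div_cancel_left) simp
    then show ?thesis
      by (simp only: times_divide_eq_right mult.assoc)
  qed
  ultimately show "copula_of M X u = 1 - harmonic_D_norm (u - 1)"
    by (simp only: assms H_avg_0_left harmonic_D_norm_eq)
qed auto

end

theorem lemma2p1:
  fixes lam :: real
    and M :: "'a measure"
    and U V S1 S2 :: "'a \<Rightarrow> real"
    and X :: "'a \<Rightarrow> real ^ 2"
  assumes "lam \<in> {- (sqrt 2 / 2)..sqrt 2 / 2}"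
    and "prob_space M"
    and "V \<in> borel_measurable M"
    and "\<And>u. 0 \<le> u \<Longrightarrow> u \<le> 1 \<Longrightarrow> cdf (distr M borel V) u = H lam u"
    and "U \<in> borel_measurable M"
    and "distr M borel U = uniform_measure lborel {0<..<1}"
    and "prob_space.indep_var M borel U borel V"
    and "S1 = U"
    and "S2 = (\<lambda>\<omega>. 1 - U \<omega>)"
    and "X = (\<lambda>\<omega>. - (V \<omega> / 2) *\<^sub>R vector [1 / S1 \<omega>, 1 / S2 \<omega>])"
  shows "(lam \<noteq> 0 \<longrightarrow> \<not> (\<exists>G. in_domain_of_attraction (copula_of M X) G)) \<and>
    (lam = 0 \<longrightarrow> is_GPC (copula_of M X)
       (\<lambda>x. if x = 0 then 0 else norm_1 x - \<bar>x $ 1\<bar> * \<bar>x $ 2\<bar> / norm_1 x))"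
proof -
  interpret sine_log_vector M lam U V X
    using assms by (simp add: sine_log_vector_def sine_log_vector_axioms_def)
  have "\<bar>lam\<bar> \<le> sqrt 2 / 2"
    using assms(1) by auto
  then show ?thesis
    using copula_of_not_in_domain_of_attraction is_GPC_copula_of
    unfolding harmonic_D_norm_def[abs_def] by blast
qed

end
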